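(* \begin{enumerate} \item Every simple slice domain in $\mathbb{H}$ is spear-simple. \item Every spear-simple domain in $\mathbb{H}$ is a hinged domain. \end{enumerate}
   Context: Basic notation. $\mathbb{H}$ is the algebra of quaternions (Euclidean topology), $\mathbb{S}=\{w\in\mathbb{H}: w^2=-1\}$. For $I\in\mathbb{S}$: $\mathbb{C}_I=\mathbb{R}+\mathbb{R}I$, $\mathbb{C}_I^{\geqslant}=\{\alpha+\beta I:\beta\ge0\}$, $\mathbb{C}_I^{>}=\{\alpha+\beta I:\beta>0\}$ ($\alpha,\beta\in\mathbb{R}$). For $T\subseteq\mathbb{H}$: $T_I=T\cap\mathbb{C}_I$, $T_I^{\geqslant}=T\cap\mathbb{C}_I^{\geqslant}$, $T_I^{>}=T\cap\mathbb{C}_I^{>}$. For $x=\alpha+\beta I$, $\mathbb{S}_x=\alpha+\beta\mathbb{S}$. $\mathbb{R}_{\mathbb{C}}=\mathbb{R}+\imath\mathbb{R}$ is a copy of the complex plane, with bijections $\phi_J:\mathbb{R}_{\mathbb{C}}\to\mathbb{C}_J$, $\alpha+\imath\beta\mapsto\alpha+\beta J$. A domain is a nonempty connected open subset of $\mathbb{H}$. A domain $\Omega$ is a slice domain if $\Omega\cap\mathbb{R}\neq\emptyset$ and $\Omega_J$ is connected for all $J\in\mathbb{S}$. An open $U\subseteq\mathbb{H}$ is speared if, for all $I\in\mathbb{S}$, each connected component of $U_I^{\geqslant}$ includes a real point. A speared domain is a domain that is a speared open set (every slice domain is a speared domain). A slice domain $\Omega$ is simple if, for all distinct $J,K\in\mathbb{S}$,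 the intersection $\phi_J^{-1}(\Omega_J^{>})\cap\phi_K^{-1}(\Omega_K^{>})$ is connected. A speared domain $\Omega$ is spear-simple if, for all distinct $J,K\in\mathbb{S}$, every connected component of $\phi_J^{-1}(\Omega_J^{\geqslant})\cap\phi_K^{-1}(\Omega_K^{\geqslant})$ intersects the real axis. Hinged points. Let $\Omega$ be a speared domain. For $J,K\in\mathbb{S}$ set $E^{J,K}=\phi_J^{-1}(\Omega_J^{\geqslant})\cap\phi_K^{-1}(\Omega_K^{\geqslant})$. Let $x_0=\alpha+\beta J_0$, $x_1=\alpha+\beta J_1$, $y_0=\alpha'+\beta'J_0$, $y_1=\alpha'+\beta'J_1$ be points of $\Omega$, with $\beta,\beta'\geq0$, $J_0,J_1\in\mathbb{S}$. We say $(x_1,y_1)$ shadows $(x_0,y_0)$ in $\Omega$ if there is a path $\gamma:[0,1]\to E^{J_0,J_1}$ with $\gamma(0)=\alpha+\beta\imath$, $\gamma(1)=\alpha'+\beta'\imath$. We say $x_1$ is strongly hinged to $x_0$ in $\Omega$ if there is $y\in\Omega\cap\mathbb{R}$ such that $(x_1,y)$ shadows $(x_0,y)$. Let $t\ge1$ be an integer, $T=\{0,\dots,t\}$ and $\{x_s\}_{s=0}^t$ a finite sequence in $\Omega$. For $s,s'\in T$ with $|s-s'|=1$, there is a simple step at $s_0=\min\{s,s'\}$ if (1) $x_{s'}$ belongs to the connected component of $\mathbb{S}_{x_s}\cap\Omega$ that includes $x_s$; or (2) $x_{s'}$ is strongly hinged to $x_s$. If (1) and (2) are false but (3) there exist $s'',s'''\in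 T\setminus\{s,s'\}$ with $s''-s'''=s'-s$ such that $(x_{s''},x_{s'''})$ shadows $(x_s,x_{s'})$, then, with $\underline{s}=\min\{s,s',s'',s'''\}$ and $\overline{s}=\max\{s,s',s'',s'''\}-1$, there is a double step at $(\underline{s},\overline{s})$. The sequence is a chain of length $t$ connecting $x_0$ and $x_t$ if, after erasing from $T$ the index $t$ and all indices where a simple step happens, there remains an even number $2\ell$ of indices, which can be listed as $\underline{s}_1,\overline{s}_1,\ldots,\underline{s}_\ell,\overline{s}_\ell$ so that for all $m,n\in\{1,\dots,\ell\}$: a double step happens at $(\underline{s}_m,\overline{s}_m)$ (whence $\underline{s}_m<\overline{s}_m$); $\underline{s}_1<\ldots<\underline{s}_\ell$; and if $m<n$ then either $\overline{s}_m<\underline{s}_n$ or $\overline{s}_m>\overline{s}_n$. For $x,x'\in\Omega$, $x'$ is hinged to $x$ in $\Omega$, written $x\sim x'$, if there is a chain connecting $x$ and $x'$. A speared domain $\Omega$ is a hinged domain if, for each $x\in\Omega$, $x\sim x'$ for all $x'\in\mathbb{S}_x\cap\Omega$. *)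

theory Defs
  imports "HOL-Analysis.Analysis"
begin

text \<open>Quaternions are pairs (real part, vector part); the product topology on this type is the
  Euclidean topology of \<open>\<real>\<^sup>4\<close>.\<close>

type_synonym quat = "real \<times> (real ^ 3)"

definition qreal :: "real \<Rightarrow> quat" where
  "qreal a = (a, 0)"

text \<open>Hamilton product in scalar/vector form.\<close>

definition qmult :: "quat \<Rightarrow> quat \<Rightarrow> quat" where
  "qmult p q = (fst p * fst q - inner (snd p) (snd q),
     fst p *\<^sub>R snd q + fst q *\<^sub>R snd p + cross3 (snd p) (snd q))"

definition qunits :: "quat set" where
  "qunits = {w. qmult w w = - qreal 1}"

definition qreals :: "quat set" where
  "qreals = range qreal"

definition slice :: "quat \<Rightarrow> quat set" where
  "slice I = {qreal a + b *\<^sub>R I | a b. True}"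

definition slice_ge :: "quat \<Rightarrow> quat set" where
  "slice_ge I = {qreal a + b *\<^sub>R I | a b. 0 \<le> b}"

definition slice_gt :: "quat \<Rightarrow> quat set" where
  "slice_gt I = {qreal a + b *\<^sub>R I | a b. 0 < b}"

text \<open>The sphere \<open>\<alpha> + \<beta> qunits\<close> through \<open>x = \<alpha> + \<beta> I\<close>. The pair \<open>(\<beta>, I)\<close> is not determined by \<open>x\<close>,
  but the sphere is, since \<open>qunits = - qunits\<close>.\<close>

definition qsphere :: "quat \<Rightarrow> quat set" where
  "qsphere x = {qreal a + b *\<^sub>R J | a b J. J \<in> qunits \<and> (\<exists>I\<in>qunits. x = qreal a + b *\<^sub>R I)}"

text \<open>The copy of the complex plane is the type \<^typ>\<open>complex\<close>.\<close>

definition phi :: "quat \<Rightarrow> complex \<Rightarrow> quat" where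
  "phi J z = qreal (Re z) + Im z *\<^sub>R J"

definition qdomain :: "quat set \<Rightarrow> bool" where
  "qdomain U \<longleftrightarrow> U \<noteq> {} \<and> connected U \<and> open U"

definition slice_domain :: "quat set \<Rightarrow> bool" where
  "slice_domain U \<longleftrightarrow> qdomain U \<and> U \<inter> qreals \<noteq> {} \<and> (\<forall>J\<in>qunits. connected (U \<inter> slice J))"

definition speared :: "quat set \<Rightarrow> bool" where
  "speared U \<longleftrightarrow> open U \<and> (\<forall>I\<in>qunits. \<forall>C\<in>components (U \<inter> slice_ge I). C \<inter> qreals \<noteq> {})"

definition speared_domain :: "quat set \<Rightarrow> bool" where
  "speared_domain U \<longleftrightarrow> qdomain U \<and> speared U"

definition common_ge :: "quat set \<Rightarrow> quat \<Rightarrow> quat \<Rightarrow> complex set" where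
  "common_ge U J K = phi J -` (U \<inter> slice_ge J) \<inter> phi K -` (U \<inter> slice_ge K)"

definition simple_slice_domain :: "quat set \<Rightarrow> bool" where
  "simple_slice_domain U \<longleftrightarrow> slice_domain U \<and>
     (\<forall>J\<in>qunits. \<forall>K\<in>qunits. J \<noteq> K \<longrightarrow>
        connected (phi J -` (U \<inter> slice_gt J) \<inter> phi K -` (U \<inter> slice_gt K)))"

definition spear_simple_domain :: "quat set \<Rightarrow> bool" where
  "spear_simple_domain U \<longleftrightarrow> speared_domain U \<and>
     (\<forall>J\<in>qunits. \<forall>K\<in>qunits. J \<noteq> K \<longrightarrow>
        (\<forall>C\<in>components (common_ge U J K). C \<inter> \<real> \<noteq> {}))"

text \<open>\<open>shadows U x1 y1 x0 y0\<close>: the pair \<open>(x1, y1)\<close> shadows \<open>(x0, y0)\<close> in \<open>U\<close>. The units \<open>J0\<close>, \<open>J1\<close>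
  are shared by the two pairs; they are not determined by the points when these are real, in which
  case any choice is admitted.\<close>

definition shadows :: "quat set \<Rightarrow> quat \<Rightarrow> quat \<Rightarrow> quat \<Rightarrow> quat \<Rightarrow> bool" where
  "shadows U x1 y1 x0 y0 \<longleftrightarrow> {x0, x1, y0, y1} \<subseteq> U \<and>
     (\<exists>a b a' b' J0 J1. 0 \<le> b \<and> 0 \<le> b' \<and> J0 \<in> qunits \<and> J1 \<in> qunits \<and>
        x0 = qreal a + b *\<^sub>R J0 \<and> x1 = qreal a + b *\<^sub>R J1 \<and>
        y0 = qreal a' + b' *\<^sub>R J0 \<and> y1 = qreal a' + b' *\<^sub>R J1 \<and>
        (\<exists>g. path g \<and> path_image g \<subseteq> common_ge U J0 J1 \<and>
             pathstart g = Complex a b \<and> pathfinish g = Complex a' b'))"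

definition strongly_hinged :: "quat set \<Rightarrow> quat \<Rightarrow> quat \<Rightarrow> bool" where
  "strongly_hinged U x1 x0 \<longleftrightarrow> (\<exists>y\<in>U \<inter> qreals. shadows U x1 y x0 y)"

definition simple_move :: "quat set \<Rightarrow> quat \<Rightarrow> quat \<Rightarrow> bool" where
  "simple_move U p q \<longleftrightarrow>
     q \<in> connected_component_set (qsphere p \<inter> U) p \<or> strongly_hinged U q p"

definition simple_step :: "quat set \<Rightarrow> nat \<Rightarrow> (nat \<Rightarrow> quat) \<Rightarrow> nat \<Rightarrow> bool" where
  "simple_step U t x s0 \<longleftrightarrow>
     (\<exists>s\<in>{0..t}. \<exists>s'\<in>{0..t}. \<bar>int s - int s'\<bar> = 1 \<and> s0 = min s s' \<and> simple_move U (x s) (x s'))"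

definition double_step :: "quat set \<Rightarrow> nat \<Rightarrow> (nat \<Rightarrow> quat) \<Rightarrow> nat \<Rightarrow> nat \<Rightarrow> bool" where
  "double_step U t x lo hi \<longleftrightarrow>
     (\<exists>s\<in>{0..t}. \<exists>s'\<in>{0..t}. \<bar>int s - int s'\<bar> = 1 \<and> \<not> simple_move U (x s) (x s') \<and>
       (\<exists>s''\<in>{0..t} - {s, s'}. \<exists>s'''\<in>{0..t} - {s, s'}.
          int s'' - int s''' = int s' - int s \<and>
          shadows U (x s'') (x s''') (x s) (x s') \<and>
          lo = Min {s, s', s'', s'''} \<and> hi = Max {s, s', s'', s'''} - 1))"

text \<open>The cardinality condition says that the \<open>2 * l\<close> listed indices are pairwise distinct.\<close>

definition chain :: "quat set \<Rightarrow> nat \<Rightarrow> (nat \<Rightarrow> quat) \<Rightarrow> bool" where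
  "chain U t x \<longleftrightarrow> 1 \<le> t \<and> (\<forall>s\<in>{0..t}. x s \<in> U) \<and>
     (\<exists>l lo hi. let R = {0..t} - {t} - {s. simple_step U t x s} in
        card R = 2 * l \<and> R = lo ` {1..l} \<union> hi ` {1..l} \<and>
        (\<forall>m\<in>{1..l}. double_step U t x (lo m) (hi m)) \<and>
        (\<forall>m\<in>{1..l}. \<forall>n\<in>{1..l}. m < n \<longrightarrow>
           lo m < lo n \<and> (hi m < lo n \<or> hi m > hi n)))"

definition hinged :: "quat set \<Rightarrow> quat \<Rightarrow> quat \<Rightarrow> bool" where
  "hinged U p q \<longleftrightarrow> (\<exists>t x. chain U t x \<and> x 0 = p \<and> x t = q)"

definition hinged_domain :: "quat set \<Rightarrow> bool" where
  "hinged_domain U \<longleftrightarrow> speared_domain U \<and> (\<forall>p\<in>U. \<forall>q\<in>qsphere p \<inter> U. hinged U p q)"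

end

theory Submission
  imports Defs
begin

text \<open>A connected component \<open>C\<close> of a relatively open subset of a closed half-plane is clopen in it.
  If \<open>C\<close> has no real point, then \<open>C\<close> is also clopen in the whole slice \<open>U \<inter> slice I\<close>, which is
  connected and has real points: so a slice domain is speared. If such a \<open>C\<close> is a component of
  \<open>common_ge U J K\<close> for a simple \<open>U\<close>, then \<open>C\<close> equals the part of that set in the open half-plane,
  whose closure contains every real point of \<open>U\<close>. Finally, in a spear-simple domain a path in
  \<open>common_ge U J K\<close> from \<open>\<alpha> + \<beta>\<i>\<close> to the real axis makes \<open>\<alpha> + \<beta>K\<close> strongly hinged to \<open>\<alpha> + \<beta>J\<close>,
  so that chains of length one suffice.\<close>

text \<open>A vector has zero cross product with itself, so the vector part of the square is
  \<open>2 * fst I\<close> times \<open>snd I\<close>. If \<open>snd I\<close> were zero, the scalar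
  part would be a real square equal to -1; hence \<open>fst I\<close> vanishes.\<close>

lemma qunits_iff: "I \<in> qunits \<longleftrightarrow> fst I = 0 \<and> norm (snd I) = 1"
proof
  assume "I \<in> qunits"
  then have eq: "qmult I I = - qreal 1"
    by (simp add: qunits_def)
  have sq: "(fst I)\<^sup>2 - snd I \<bullet> snd I = - 1"
    using arg_cong[OF eq, of fst] by (simp add: qmult_def qreal_def power2_eq_square)
  have "fst I *\<^sub>R snd I + fst I *\<^sub>R snd I = 0"
    using arg_cong[OF eq, of snd] by (simp add: qmult_def qreal_def)
  then have lin: "(2 * fst I) *\<^sub>R snd I = 0"
    by (metis mult_2 scaleR_left.add)
  have "snd I \<noteq> 0"
    using sq zero_le_power2[of "fst I"] by fastforce
  with lin have "fst I = 0" by simp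
  with sq show "fst I = 0 \<and> norm (snd I) = 1"
    by (simp add: norm_eq_1)
next
  assume "fst I = 0 \<and> norm (snd I) = 1"
  then show "I \<in> qunits"
    by (auto simp: qunits_def qmult_def qreal_def prod_eq_iff norm_eq_1)
qed

lemma uminus_qunits: "I \<in> qunits \<Longrightarrow> - I \<in> qunits"
  by (simp add: qunits_iff)

text \<open>Recovers the coefficient \<open>b\<close> from the point, so that the half-planes of a
  slice are cut out by inequalities on a continuous function.\<close>

lemma inner_snd_slice: "I \<in> qunits \<Longrightarrow> snd (qreal a + b *\<^sub>R I) \<bullet> snd I = b"
  by (simp add: qunits_iff qreal_def norm_eq_1)

lemma slice_ge_eq: "I \<in> qunits \<Longrightarrow> slice_ge I = slice I \<inter> {x. 0 \<le> snd x \<bullet> snd I}"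
  unfolding slice_ge_def slice_def
  by (rule set_eqI, simp only: Int_iff mem_Collect_eq) (metis inner_snd_slice)

lemma slice_gt_eq: "I \<in> qunits \<Longrightarrow> slice_gt I = slice I \<inter> {x. 0 < snd x \<bullet> snd I}"
  unfolding slice_gt_def slice_def
  by (rule set_eqI, simp only: Int_iff mem_Collect_eq) (metis inner_snd_slice)

lemma phi_in_slice_ge: "I \<in> qunits \<Longrightarrow> phi I z \<in> slice_ge I \<longleftrightarrow> 0 \<le> Im z"
  unfolding slice_ge_def phi_def by (simp only: mem_Collect_eq) (metis inner_snd_slice)

lemma phi_in_slice_gt: "I \<in> qunits \<Longrightarrow> phi I z \<in> slice_gt I \<longleftrightarrow> 0 < Im z"
  unfolding slice_gt_def phi_def by (simp only: mem_Collect_eq) (metis inner_snd_slice)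

lemma phi_of_real: "phi I (of_real r) = qreal r"
  by (simp add: phi_def)

lemma linear_phi: "linear (phi I)"
  by (rule linearI) (auto simp: phi_def qreal_def algebra_simps prod_eq_iff)

lemma continuous_on_phi: "continuous_on S (phi I)"
  by (simp add: linear_continuous_on linear_conv_bounded_linear[symmetric] linear_phi)

lemma convex_slice: "convex (slice I)"
proof -
  have "slice I = range (phi I)"
    unfolding slice_def phi_def image_def by (metis UNIV_I complex.sel)
  then show ?thesis
    by (simp add: convex_linear_image linear_phi)
qed

lemma convex_slice_ge: "I \<in> qunits \<Longrightarrow> convex (slice_ge I)"
proof -
  assume "I \<in> qunits"
  moreover have "convex {x::quat. 0 \<le> snd x \<bullet> snd I}"
    by (auto simp: convex_def inner_add_left)
  ultimately show ?thesis
    by (simp add: slice_ge_eq convex_slice convex_Int)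
qed

lemma qreals_subset_slice_ge: "qreals \<subseteq> slice_ge I"
proof
  fix x
  assume "x \<in> qreals"
  then obtain a where "x = qreal a + 0 *\<^sub>R I"
    by (auto simp: qreals_def)
  then show "x \<in> slice_ge I"
    unfolding slice_ge_def by blast
qed

lemma slice_ge_minus_qreals: "slice_ge I - qreals \<subseteq> slice_gt I"
proof
  fix x
  assume x: "x \<in> slice_ge I - qreals"
  then obtain a b where ab: "x = qreal a + b *\<^sub>R I" "0 \<le> b"
    by (auto simp: slice_ge_def)
  with x have "b \<noteq> 0"
    by (auto simp: qreals_def)
  with ab show "x \<in> slice_gt I"
    unfolding slice_gt_def by force
qed

lemma common_ge_eq:
  assumes "J \<in> qunits" "K \<in> qunits"
  shows "common_ge U J K = {z. 0 \<le> Im z} \<inter> (phi J -` U \<inter> phi K -` U)"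
  using assms by (simp add: set_eq_iff common_ge_def phi_in_slice_ge) blast

lemma open_phi_vimage: "open U \<Longrightarrow> open (phi I -` U)"
  by (simp add: continuous_on_phi open_vimage)

text \<open>The set is relatively open in a convex half-plane. This turns its components into path
  components, as \<open>shadows\<close> asks for an actual path.\<close>

lemma locally_path_connected_common_ge:
  assumes "J \<in> qunits" "K \<in> qunits" "open U"
  shows "locally path_connected (common_ge U J K)"
proof (rule locally_open_subset)
  show "locally path_connected {z. 0 \<le> Im z}"
    by (simp add: convex_halfspace_Im_ge convex_imp_locally_path_connected)
  show "openin (top_of_set {z. 0 \<le> Im z}) (common_ge U J K)"
    using assms by (simp add: common_ge_eq openin_open_Int open_phi_vimage open_Int)
qed

lemma slice_domain_speared:
  assumes "slice_domain U"
  shows "speared U"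
  unfolding speared_def
proof (intro conjI ballI)
  show opU: "open U"
    using assms by (simp add: slice_domain_def qdomain_def)
  fix I C
  assume I: "I \<in> qunits" and C: "C \<in> components (U \<inter> slice_ge I)"
  show "C \<inter> qreals \<noteq> {}"
  proof
    assume noreal: "C \<inter> qreals = {}"
    have Csub: "C \<subseteq> U \<inter> slice_ge I" "C \<noteq> {}"
      using C in_components_subset in_components_nonempty by blast+
    with noreal have Cgt: "C \<subseteq> slice_gt I"
      using slice_ge_minus_qreals by blast
    have "locally connected (U \<inter> slice_ge I)"
      by (rule locally_open_subset[OF convex_imp_locally_connected[OF convex_slice_ge[OF I]]])
        (metis Int_commute openin_open_Int opU)
    then have "openin (top_of_set (U \<inter> slice_ge I)) C"
      using C openin_components_locally_connected by blast
    then obtain T where T: "open T" "C = (U \<inter> slice_ge I) \<inter> T"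
      by (auto simp: openin_open)
    \<comment> \<open>Without real points, \<open>C\<close> satisfies the strict inequality. Adding
      it to \<open>T\<close> removes the boundary line, so openness passes from the closed
      half-plane to the whole slice.\<close>
    have "C = (U \<inter> slice I) \<inter> (T \<inter> {x. 0 < snd x \<bullet> snd I})"
      using T Cgt I by (auto simp: slice_ge_eq slice_gt_eq)
    moreover have "open (T \<inter> {x. 0 < snd x \<bullet> snd I})"
      by (intro open_Int T open_Collect_less continuous_intros)
    ultimately have op: "openin (top_of_set (U \<inter> slice I)) C"
      by (auto simp: openin_open)
    have "closed {x::quat. 0 \<le> snd x \<bullet> snd I}"
      by (intro closed_Collect_le continuous_intros)
    then have "closedin (top_of_set (U \<inter> slice I)) (U \<inter> slice_ge I)"
      using I by (auto simp: closedin_closed slice_ge_eq)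
    then have cl: "closedin (top_of_set (U \<inter> slice I)) C"
      using closedin_component[OF C] closedin_trans by blast
    have "connected (U \<inter> slice I)"
      using assms I by (simp add: slice_domain_def)
    then have "C = U \<inter> slice I"
      using op cl Csub(2) unfolding connected_clopen by blast
    moreover have "U \<inter> slice I \<inter> qreals \<noteq> {}"
      using assms I qreals_subset_slice_ge[of I] by (auto simp: slice_domain_def slice_ge_eq)
    ultimately show False
      using noreal by simp
  qed
qed

lemma simple_slice_domain_imp_spear_simple_domain:
  assumes "simple_slice_domain U"
  shows "spear_simple_domain U"
  unfolding spear_simple_domain_def speared_domain_def
proof (intro conjI ballI impI)
  have sd: "slice_domain U"
    using assms by (simp add: simple_slice_domain_def)
  then show "qdomain U" "speared U"
    by (simp_all add: slice_domain_def slice_domain_speared)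
  fix J K C
  assume J: "J \<in> qunits" and K: "K \<in> qunits" and "J \<noteq> K"
    and C: "C \<in> components (common_ge U J K)"
  define V where "V = phi J -` U \<inter> phi K -` U"
  have opV: "open V"
    using sd unfolding V_def slice_domain_def qdomain_def by (blast intro: open_Int open_phi_vimage)
  have E: "common_ge U J K = {z. 0 \<le> Im z} \<inter> V"
    using J K by (simp add: common_ge_eq V_def)
  have "phi J -` (U \<inter> slice_gt J) \<inter> phi K -` (U \<inter> slice_gt K) = {z. 0 < Im z} \<inter> V"
    using J K by (simp add: set_eq_iff V_def phi_in_slice_gt) blast
  then have conn: "connected ({z. 0 < Im z} \<inter> V)"
    using assms J K \<open>J \<noteq> K\<close> by (metis simple_slice_domain_def)
  show "C \<inter> \<real> \<noteq> {}"
  proof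
    assume noreal: "C \<inter> \<real> = {}"
    have Csub: "C \<subseteq> {z. 0 \<le> Im z} \<inter> V" "C \<noteq> {}"
      using C E in_components_subset in_components_nonempty by blast+
    have "C \<subseteq> {z. 0 < Im z} \<inter> V"
    proof
      fix z assume "z \<in> C"
      then have "z \<notin> \<real>" "0 \<le> Im z" "z \<in> V"
        using noreal Csub by auto
      then show "z \<in> {z. 0 < Im z} \<inter> V"
        by (auto simp: complex_is_Real_iff less_le)
    qed
    \<comment> \<open>The connected upper part contains the nonempty \<open>C\<close>, so it meets
      this component and is absorbed by it.\<close>
    then have gtC: "{z. 0 < Im z} \<inter> V \<subseteq> C"
      using Csub(2) by (intro components_maximal[OF C conn]) (auto simp: E)
    obtain r where r: "qreal r \<in> U"
      using sd by (auto simp: slice_domain_def qreals_def)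
    then have rV: "complex_of_real r \<in> V"
      by (simp add: V_def phi_of_real)
    \<comment> \<open>The inner product with \<open>\<i>\<close> is the imaginary part, so the
      closure of the open half-plane contains the real axis.\<close>
    have "complex_of_real r \<in> closure {z. 0 < Im z}"
      using closure_halfspace_gt[of \<i> 0] by (simp add: inner_complex_def)
    then have "complex_of_real r \<in> closure (V \<inter> {z. 0 < Im z})"
      using rV open_Int_closure_subset[OF opV] by blast
    then have "complex_of_real r \<in> closure C"
      using gtC closure_mono by (metis Int_commute subsetD)
    \<comment> \<open>\<open>C\<close> is closed only relative to \<open>common_ge U J K\<close>;
      the limit point \<open>r\<close> lies in that set, hence in \<open>C\<close>.\<close>
    moreover obtain T where "closed T" "C = common_ge U J K \<inter> T"
      using closedin_component[OF C] by (auto simp: closedin_closed)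
    ultimately have "complex_of_real r \<in> C"
      using rV closure_minimal[of C T] by (auto simp: E)
    with noreal show False
      by auto
  qed
qed

lemma hinged_simple_move:
  assumes "p \<in> U" "q \<in> U" "simple_move U p q"
  shows "hinged U p q"
proof -
  define x where "x = (\<lambda>n::nat. if n = 0 then p else q)"
  have "simple_step U 1 x 0"
    unfolding simple_step_def
    by (rule bexI[of _ 0], rule bexI[of _ 1]) (use assms in \<open>auto simp: x_def\<close>)
  \<comment> \<open>Index 1 is erased as the final index and index 0 by the simple step, so
    \<open>l = 0\<close> below and no double step has to be exhibited.\<close>
  then have R: "{0..1} - {1} - {s. simple_step U 1 x s} = {}"
    by (auto simp: le_Suc_eq)
  have "chain U 1 x"
    unfolding chain_def Let_def R
    by (intro conjI exI[of _ 0]) (use assms in \<open>auto simp: x_def\<close>)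
  moreover have "x 0 = p" "x 1 = q"
    by (auto simp: x_def)
  ultimately show ?thesis
    unfolding hinged_def by blast
qed

lemma spear_simple_strongly_hinged:
  assumes U: "spear_simple_domain U" and I: "I \<in> qunits" and J: "J \<in> qunits" and "I \<noteq> J"
    and b: "0 \<le> b" and pU: "qreal a + b *\<^sub>R I \<in> U" and qU: "qreal a + b *\<^sub>R J \<in> U"
  shows "strongly_hinged U (qreal a + b *\<^sub>R J) (qreal a + b *\<^sub>R I)"
proof -
  let ?E = "common_ge U I J" and ?z = "Complex a b"
  have opU: "open U"
    using U by (simp add: spear_simple_domain_def speared_domain_def qdomain_def)
  have z: "?z \<in> ?E"
    using assms by (simp add: common_ge_eq phi_def)
  then have "connected_component_set ?E ?z \<in> components ?E"
    by (auto simp: components_def)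
  then have "connected_component_set ?E ?z \<inter> \<real> \<noteq> {}"
    using U I J \<open>I \<noteq> J\<close> unfolding spear_simple_domain_def by blast
  then obtain r where r: "connected_component ?E ?z (complex_of_real r)"
    by (auto elim!: Reals_cases)
  then have "path_component ?E ?z (complex_of_real r)"
    using path_component_eq_connected_component[OF locally_path_connected_common_ge[OF I J opU]]
    by metis
  then obtain g where g: "path g" "path_image g \<subseteq> ?E" "pathstart g = ?z"
      "pathfinish g = Complex r 0"
    by (auto simp: path_component_def complex_of_real_def)
  have "complex_of_real r \<in> ?E"
    using r connected_component_in by blast
  then have rU: "qreal r \<in> U"
    using I J by (simp add: common_ge_eq phi_of_real)
  have "shadows U (qreal a + b *\<^sub>R J) (qreal r) (qreal a + b *\<^sub>R I) (qreal r)"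
    unfolding shadows_def
    apply (intro conjI)
    subgoal using pU qU rU by simp
    subgoal
      \<comment> \<open>At height 0 the choice of unit is immaterial: \<open>qreal r\<close> lies
        over the end of \<open>g\<close> for both \<open>I\<close> and \<open>J\<close>, and serves
        as both endpoints.\<close>
      apply (rule exI[of _ a], rule exI[of _ b], rule exI[of _ r], rule exI[of _ 0],
             rule exI[of _ I], rule exI[of _ J])
      using b I J g by auto
    done
  then show ?thesis
    using rU by (auto simp: strongly_hinged_def qreals_def)
qed

text \<open>The coefficient in \<open>qsphere\<close> may be negative; changing the signs of
  \<open>b\<close>, \<open>I\<close> and \<open>J\<close> together keeps both points and makes it
  nonnegative.\<close>

lemma qsphere_cases:
  assumes "q \<in> qsphere p"
  obtains a b I J where "0 \<le> b" "I \<in> qunits" "J \<in> qunits"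
    "p = qreal a + b *\<^sub>R I" "q = qreal a + b *\<^sub>R J"
proof -
  obtain a b I J where *: "I \<in> qunits" "J \<in> qunits" "p = qreal a + b *\<^sub>R I" "q = qreal a + b *\<^sub>R J"
    using assms unfolding qsphere_def by blast
  show thesis
  proof (cases "0 \<le> b")
    case True
    with * that show thesis by blast
  next
    case False
    with * that[of "- b" "- I" "- J" a] show thesis
      by (simp add: uminus_qunits)
  qed
qed

lemma spear_simple_domain_imp_hinged_domain:
  assumes U: "spear_simple_domain U"
  shows "hinged_domain U"
  unfolding hinged_domain_def
proof (intro conjI ballI)
  show "speared_domain U"
    using U by (simp add: spear_simple_domain_def)
  fix p q
  assume p: "p \<in> U" and q: "q \<in> qsphere p \<inter> U"
  then have "q \<in> qsphere p" by blast
  then obtain a b I J where *: "0 \<le> b" "I \<in> qunits" "J \<in> qunits"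
    "p = qreal a + b *\<^sub>R I" "q = qreal a + b *\<^sub>R J"
    by (rule qsphere_cases)
  have "simple_move U p q"
  \<comment> \<open>Spear-simplicity only concerns distinct units. For equal units the points
    coincide, and a point belongs to its own component.\<close>
  proof (cases "I = J")
    case True
    with * have "q = p" by simp
    then show ?thesis
      using p q by (simp add: simple_move_def)
  next
    case False
    then show ?thesis
      using * p q spear_simple_strongly_hinged[OF U] by (simp add: simple_move_def)
  qed
  then show "hinged U p q"
    using p q by (simp add: hinged_simple_move)
qed

theorem proposition6p6:
  shows "(\<forall>U. simple_slice_domain U \<longrightarrow> spear_simple_domain U) \<and>
         (\<forall>U. spear_simple_domain U \<longrightarrow> hinged_domain U)"
  using simple_slice_domain_imp_spear_simple_domain spear_simple_domain_imp_hinged_domain by blast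

end
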